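(* Let $\eta : \mathbb{Z}^2 \to \{0,1\}$ be a regular cluster with at least 11 vertices (that is, at least 11 vertices of type 1). Then $$\sum_{x \in \mathbb{Z}^2} \phi(\eta, x) = 9\,(c_- - c_+),$$ where $c_+$ and $c_-$ are the numbers of positive and negative corners of $\eta$, respectively, and $\phi(\eta,x)$ is the variation of the number of type 1 vertices when the $3 \times 3$ square centered at $x$ is updated according to the majority rule.
   Context: A configuration is a function $\eta : \mathbb{Z}^2 \to \{0,1\}$, also identified with the set of vertices $x$ with $\eta(x) = 1$ (type 1 vertices; the others are of type 0). Let $e_1, e_2$ be the unit vectors of the plane, $\mathbb{D}^2 = \mathbb{Z}^2 + (1/2,1/2)$ the dual lattice and $D_2 = [-1,1]^2$. Contour: the contour $\Gamma$ of $\eta$ is the topological boundary in $\mathbb{R}^2$ of the union of the closed unit squares $x + [-1/2,1/2]^2$ over all $x$ with $\eta(x) = 1$. Corners: a vertex $x \in \mathbb{Z}^2$ is a corner if $\eta(x - e_1 - e_2) = \eta(x + e_1 + e_2) \neq \eta(x)$ or $\eta(x - e_1 + e_2) = \eta(x + e_1 - e_2) \neq \eta(x)$. A corner $x$ is positive if $\eta(x) = 1$ and negative if $\eta(x) = 0$. Clusters: $\eta$ is a cluster if its contour $\Gamma$ is a Jordan curve (a non-self-intersecting loop); by convention the vertices in the bounded region delimited by $\Gamma$ are of type 1 and the vertices in the unbounded region are of type 0. A cluster $\eta$ is a regular cluster if in addition (1) the set $(x + D_2) \cap \Gamma$ is connected for all $x \in \mathbb{D}^2$ (the empty set counting as connected),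 and (2) if $x$ is a corner and $y \neq x$ is a vertex with $(x + D_2) \cap (y + D_2) \neq \varnothing$, then $y$ is not a corner. Majority rule update: updating the $3 \times 3$ square $Q_x = x + \{-1,0,1\}^2$ sets all nine vertices of $Q_x$ to the majority type in $Q_x$. Thus $\phi(\eta, x) = 9 - \operatorname{card}(\eta \cap Q_x)$ if $\operatorname{card}(\eta \cap Q_x) \geq 5$, and $\phi(\eta,x) = -\operatorname{card}(\eta \cap Q_x)$ otherwise. When $\eta$ is a cluster, $\phi(\eta,x) = 0$ for all but finitely many $x$. *)

theory Defs
  imports "HOL-Analysis.Analysis"
begin

definition configuration :: "(int \<times> int \<Rightarrow> nat) \<Rightarrow> bool" where
  "configuration \<eta> \<longleftrightarrow> range \<eta> \<subseteq> {0, 1}"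

definition type1 :: "(int \<times> int \<Rightarrow> nat) \<Rightarrow> (int \<times> int) set" where
  "type1 \<eta> = {x. \<eta> x = 1}"

definition e1 :: "int \<times> int" where "e1 = (1, 0)"

definition e2 :: "int \<times> int" where "e2 = (0, 1)"

definition point :: "int \<times> int \<Rightarrow> real \<times> real" where
  "point x = (of_int (fst x), of_int (snd x))"

definition dual_lattice :: "(real \<times> real) set" where
  "dual_lattice = range (\<lambda>x. point x + (1/2, 1/2))"

definition unit_square :: "(real \<times> real) set" where
  "unit_square = {-1/2..1/2} \<times> {-1/2..1/2}"

definition D2 :: "(real \<times> real) set" where
  "D2 = {-1..1} \<times> {-1..1}"

definition contour :: "(int \<times> int \<Rightarrow> nat) \<Rightarrow> (real \<times> real) set" where
  "contour \<eta> = frontier (\<Union>x\<in>type1 \<eta>. (+) (point x) ` unit_square)"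

definition Jordan_curve :: "(real \<times> real) set \<Rightarrow> bool" where
  "Jordan_curve S \<longleftrightarrow>
     (\<exists>g. simple_path g \<and> pathfinish g = pathstart g \<and> path_image g = S)"

text \<open>The last two conjuncts express the convention that the vertices enclosed by the contour,
  and not those around it, are of type 1: the complement of a cluster has the same contour.\<close>

definition cluster :: "(int \<times> int \<Rightarrow> nat) \<Rightarrow> bool" where
  "cluster \<eta> \<longleftrightarrow> configuration \<eta> \<and> Jordan_curve (contour \<eta>) \<and>
     (\<forall>x. point x \<in> inside (contour \<eta>) \<longrightarrow> \<eta> x = 1) \<and>
     (\<forall>x. point x \<in> outside (contour \<eta>) \<longrightarrow> \<eta> x = 0)"

definition corner :: "(int \<times> int \<Rightarrow> nat) \<Rightarrow> int \<times> int \<Rightarrow> bool" where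
  "corner \<eta> x \<longleftrightarrow>
     (\<eta> (x - e1 - e2) = \<eta> (x + e1 + e2) \<and> \<eta> (x + e1 + e2) \<noteq> \<eta> x) \<or>
     (\<eta> (x - e1 + e2) = \<eta> (x + e1 - e2) \<and> \<eta> (x + e1 - e2) \<noteq> \<eta> x)"

definition positive_corners :: "(int \<times> int \<Rightarrow> nat) \<Rightarrow> (int \<times> int) set" where
  "positive_corners \<eta> = {x. corner \<eta> x \<and> \<eta> x = 1}"

definition negative_corners :: "(int \<times> int \<Rightarrow> nat) \<Rightarrow> (int \<times> int) set" where
  "negative_corners \<eta> = {x. corner \<eta> x \<and> \<eta> x = 0}"

definition regular_cluster :: "(int \<times> int \<Rightarrow> nat) \<Rightarrow> bool" where
  "regular_cluster \<eta> \<longleftrightarrow> cluster \<eta> \<and>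
     (\<forall>z\<in>dual_lattice. connected ((+) z ` D2 \<inter> contour \<eta>)) \<and>
     (\<forall>x y. corner \<eta> x \<and> y \<noteq> x \<and> (+) (point x) ` D2 \<inter> (+) (point y) ` D2 \<noteq> {}
        \<longrightarrow> \<not> corner \<eta> y)"

definition Q :: "int \<times> int \<Rightarrow> (int \<times> int) set" where
  "Q x = (+) x ` ({-1, 0, 1} \<times> {-1, 0, 1})"

definition majority_update :: "(int \<times> int \<Rightarrow> nat) \<Rightarrow> int \<times> int \<Rightarrow> int \<times> int \<Rightarrow> nat" where
  "majority_update \<eta> x y =
     (if y \<in> Q x then (if card (type1 \<eta> \<inter> Q x) \<ge> 5 then 1 else 0) else \<eta> y)"

definition \<phi> :: "(int \<times> int \<Rightarrow> nat) \<Rightarrow> int \<times> int \<Rightarrow> int" where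
  "\<phi> \<eta> x = (if card (type1 \<eta> \<inter> Q x) \<ge> 5 then 9 - int (card (type1 \<eta> \<inter> Q x))
             else - int (card (type1 \<eta> \<inter> Q x)))"

text \<open>An update changes nothing outside \<open>Q x\<close>, so \<open>\<phi> \<eta> x\<close> is indeed the variation of the number
  of type 1 vertices.\<close>

lemma phi_eq_variation:
  "\<phi> \<eta> x = int (card (type1 (majority_update \<eta> x) \<inter> Q x)) - int (card (type1 \<eta> \<inter> Q x))"
proof -
  have "card (Q x) = card ({-1, 0, 1 :: int} \<times> {-1, 0, 1 :: int})"
    unfolding Q_def by (rule card_image) simp
  then have card_Q: "card (Q x) = 9"
    by (simp add: card_cartesian_product)
  show ?thesis
  proof (cases "card (type1 \<eta> \<inter> Q x) \<ge> 5")
    case True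
    then have "type1 (majority_update \<eta> x) \<inter> Q x = Q x"
      by (auto simp: type1_def majority_update_def)
    with True card_Q show ?thesis by (simp add: \<phi>_def)
  next
    case False
    then have "type1 (majority_update \<eta> x) \<inter> Q x = {}"
      by (auto simp: type1_def majority_update_def)
    with False show ?thesis by (simp add: \<phi>_def)
  qed
qed

end

theory Submission
  imports Defs
begin

text \<open>An update replaces the type 1 vertices of \<open>Q x\<close> by \<open>9\<close> of them if the majority is of
  type 1, and by none otherwise. Each type 1 vertex lies in nine of the
  squares, so the sum of all variations is \<open>9\<close> times the difference between the number of squares
  with a type 1 majority and the number of type 1 vertices (lemma \<open>has_sum_phi\<close>). It remains to
  see at which vertices \<open>x\<close> the majority in \<open>Q x\<close> differs from the type of \<open>x\<close>: these are exactly
  the corners (lemma \<open>majority_iff\<close>). A positive corner thus is a type 1 vertex without a type 1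
  majority around it, and a negative corner is a type 0 vertex with one.

  The majority statement is local and rests on two properties of the contour.

  First, no \<open>2 \<times> 2\<close> block of vertices is coloured like a checkerboard. At the centre of such a
  block four edges of the contour would meet, whereas already three disjoint arms cannot end at
  a common point of a Jordan curve: the curve without this point is an open interval, each arm
  is a subinterval reaching one of the two ends, and two of the arms would have to reach the
  same end (lemma \<open>Jordan_curve_no_triod\<close>).

  Second, suppose that exactly one vertex \<open>v\<close> of a \<open>2 \<times> 2\<close> block differs from the other
  three, so that the contour turns at the centre \<open>p\<close> of the block. Both of its edges at \<open>p\<close> lie
  on the side of \<open>v\<close>. Let \<open>x\<close> be the vertex of the block opposite to \<open>v\<close>. The translate of \<open>D2\<close>
  that has \<open>p\<close> as its corner nearest to \<open>v\<close> meets these edges in \<open>p\<close> only, so \<open>p\<close> is isolated in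
  the part of the contour that it contains. As this part is connected, it is just \<open>{p}\<close>. Hence all
  vertices of \<open>Q x\<close> other than \<open>v\<close> have the same type (lemma \<open>turn_fills_square\<close>). A case
  analysis of the nine vertices of \<open>Q x\<close> concludes (lemma \<open>majority_of_nine\<close>).\<close>

section \<open>The contour in terms of unit squares\<close>

definition cell :: "int \<times> int \<Rightarrow> (real \<times> real) set" where
  "cell c = (+) (point c) ` unit_square"

lemma mem_cell_iff:
  "q \<in> cell c \<longleftrightarrow>
     \<bar>fst q - of_int (fst c)\<bar> \<le> 1/2 \<and> \<bar>snd q - of_int (snd c)\<bar> \<le> 1/2"
proof -
  have "q \<in> cell c \<longleftrightarrow> q - point c \<in> unit_square"
    unfolding cell_def by (metis (no_types, lifting) add_diff_cancel_left' diff_add_cancel add.commute imageE imageI)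
  then show ?thesis
    by (cases q) (auto simp: unit_square_def point_def abs_if split: if_splits)
qed

text \<open>Only the half-integers bounding the unit intervals around integers matter, so \<open>\<epsilon>\<close> is the
  distance from \<open>a\<close> to the nearest half-integer other than \<open>a\<close> itself.\<close>

lemma half_neighbours_locally:
  fixes a :: real
  obtains \<epsilon> where "\<epsilon> > 0"
    "\<And>a' i. \<bar>a' - a\<bar> < \<epsilon> \<Longrightarrow> \<bar>a' - of_int i\<bar> \<le> 1/2 \<Longrightarrow> \<bar>a - of_int i\<bar> \<le> 1/2"
proof -
  define k where "k = \<lfloor>a + 1/2\<rfloor>"
  have k: "of_int k - 1/2 \<le> a" "a < of_int k + 1/2"
    unfolding k_def by linarith+
  define \<epsilon> where
    "\<epsilon> = min (of_int k + 1/2 - a) (if a = of_int k - 1/2 then 1 else a - (of_int k - 1/2))"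
  have "\<epsilon> > 0"
    using k by (auto simp: \<epsilon>_def)
  moreover have "\<bar>a - of_int i\<bar> \<le> 1/2"
    if "\<bar>a' - a\<bar> < \<epsilon>" "\<bar>a' - of_int i\<bar> \<le> 1/2" for a' and i :: int
  proof (cases "i \<ge> k + 1")
    case True
    then have "real_of_int i \<ge> of_int k + 1" by linarith
    with that k show ?thesis by (auto simp: \<epsilon>_def)
  next
    case False
    show ?thesis
    proof (cases "i = k")
      case True
      with k show ?thesis by (auto simp: abs_if)
    next
      case False
      with \<open>\<not> i \<ge> k + 1\<close> have i: "i \<le> k - 1" by linarith
      show ?thesis
      proof (cases "a = of_int k - 1/2 \<and> i = k - 1")
        case True
        then show ?thesis by auto
      next
        case False
        with i have "a \<noteq> of_int k - 1/2 \<or> real_of_int i \<le> of_int k - 2" by linarith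
        moreover have "real_of_int i \<le> of_int k - 1" using i by linarith
        ultimately show ?thesis using that k by (auto simp: \<epsilon>_def split: if_splits)
      qed
    qed
  qed
  ultimately show ?thesis by (rule that)
qed

text \<open>The squares form a locally finite family of closed sets.\<close>

lemma cells_locally:
  obtains T where "open T" "q \<in> T"
    "\<And>c. T \<inter> cell c \<noteq> {} \<Longrightarrow> q \<in> cell c"
proof -
  obtain \<epsilon> where \<epsilon>: "\<epsilon> > 0"
    "\<And>a' i. \<bar>a' - fst q\<bar> < \<epsilon> \<Longrightarrow> \<bar>a' - of_int i\<bar> \<le> 1/2 \<Longrightarrow> \<bar>fst q - of_int i\<bar> \<le> 1/2"
    using half_neighbours_locally[of "fst q"] by blast
  obtain \<delta> where \<delta>: "\<delta> > 0"
    "\<And>a' i. \<bar>a' - snd q\<bar> < \<delta> \<Longrightarrow> \<bar>a' - of_int i\<bar> \<le> 1/2 \<Longrightarrow> \<bar>snd q - of_int i\<bar> \<le> 1/2"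
    using half_neighbours_locally[of "snd q"] by blast
  let ?T = "{fst q - \<epsilon><..<fst q + \<epsilon>} \<times> {snd q - \<delta><..<snd q + \<delta>}"
  show ?thesis
  proof (rule that)
    show "open ?T" by (intro open_Times) auto
    show "q \<in> ?T" using \<epsilon>(1) \<delta>(1) by (cases q) auto
    fix c assume "?T \<inter> cell c \<noteq> {}"
    then obtain r where r: "r \<in> ?T" "r \<in> cell c" by blast
    from r(1) have "\<bar>fst r - fst q\<bar> < \<epsilon>" "\<bar>snd r - snd q\<bar> < \<delta>"
      by (cases r; auto)+
    with r(2) \<epsilon>(2) \<delta>(2) show "q \<in> cell c"
      by (auto simp: mem_cell_iff)
  qed
qed

lemma cell_subset_closure:
  fixes c :: "int \<times> int"
  shows "cell c \<subseteq>
    closure {q. \<bar>fst q - of_int (fst c)\<bar> < 1/2 \<and> \<bar>snd q - of_int (snd c)\<bar> < 1/2}"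
proof -
  let ?a = "real_of_int (fst c)" and ?b = "real_of_int (snd c)"
  have "{q. \<bar>fst q - ?a\<bar> < 1/2 \<and> \<bar>snd q - ?b\<bar> < 1/2}
      = {?a - 1/2<..<?a + 1/2} \<times> {?b - 1/2<..<?b + 1/2}"
    by (auto simp: mem_Times_iff abs_if split: if_splits)
  moreover have "closure \<dots> = {?a - 1/2..?a + 1/2} \<times> {?b - 1/2..?b + 1/2}"
    by (simp add: closure_Times)
  ultimately show ?thesis
    by (auto simp: mem_cell_iff abs_if mem_Times_iff split: if_splits)
qed

text \<open>This turns membership in the contour into a question about the at most four vertices whose
  squares contain the point. A point of squares of type 1 only is interior to their union, by
  local finiteness; and the union misses the interior of a square of type 0, hence a point of
  such a square is not interior to the union.\<close>

lemma contour_iff: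
  "q \<in> contour \<eta> \<longleftrightarrow>
     (\<exists>c d. q \<in> cell c \<and> q \<in> cell d \<and>
       \<eta> c = 1 \<and> \<eta> d \<noteq> 1)"
proof -
  define U where "U = (\<Union>x\<in>type1 \<eta>. cell x)"
  obtain T where T: "open T" "q \<in> T"
    "\<And>c. T \<inter> cell c \<noteq> {} \<Longrightarrow> q \<in> cell c"
    using cells_locally[of q] by blast
  have *: "q \<in> closure U \<longleftrightarrow> (\<exists>c. q \<in> cell c \<and> \<eta> c = 1)"
  proof
    assume "q \<in> closure U"
    with T have "T \<inter> U \<noteq> {}" by (metis IntI empty_iff open_Int_closure_eq_empty)
    then obtain c where "T \<inter> cell c \<noteq> {}" "\<eta> c = 1"
      unfolding U_def type1_def by blast
    with T(3) show "\<exists>c. q \<in> cell c \<and> \<eta> c = 1" by blast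
  next
    assume "\<exists>c. q \<in> cell c \<and> \<eta> c = 1"
    then have "q \<in> U" by (auto simp: U_def type1_def)
    then show "q \<in> closure U" using closure_subset by blast
  qed
  have **: "q \<notin> interior U \<longleftrightarrow> (\<exists>d. q \<in> cell d \<and> \<eta> d \<noteq> 1)"
  proof
    assume ni: "q \<notin> interior U"
    with T have "\<not> T \<subseteq> U" by (auto simp: interior_def)
    then obtain r where r: "r \<in> T" "r \<notin> U" by blast
    define d where "d = (round (fst r), round (snd r))"
    have "r \<in> cell d"
      unfolding mem_cell_iff d_def
      using of_int_round_abs_le[of "fst r"] of_int_round_abs_le[of "snd r"]
      by (simp add: abs_minus_commute)
    with r have "T \<inter> cell d \<noteq> {}" "\<eta> d \<noteq> 1"
      unfolding U_def type1_def by blast+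
    with T(3) show "\<exists>d. q \<in> cell d \<and> \<eta> d \<noteq> 1" by blast
  next
    assume "\<exists>d. q \<in> cell d \<and> \<eta> d \<noteq> 1"
    then obtain d where d: "q \<in> cell d" "\<eta> d \<noteq> 1" by blast
    let ?O = "{q. \<bar>fst q - of_int (fst d)\<bar> < 1/2 \<and> \<bar>snd q - of_int (snd d)\<bar> < (1/2::real)}"
    have "?O \<inter> U = {}"
    proof (rule ccontr)
      assume "?O \<inter> U \<noteq> {}"
      then obtain r c where r: "r \<in> ?O" "r \<in> cell c" "\<eta> c = 1"
        unfolding U_def type1_def by blast
      then have "\<bar>real_of_int (fst c) - of_int (fst d)\<bar> < 1"
        "\<bar>real_of_int (snd c) - of_int (snd d)\<bar> < 1"
        unfolding mem_cell_iff mem_Collect_eq by linarith+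
      then have "c = d" by (intro prod_eqI) linarith+
      with r d show False by simp
    qed
    then have "interior U \<inter> ?O = {}" using interior_subset by blast
    then have "interior U \<inter> closure ?O = {}"
      by (simp add: open_Int_closure_eq_empty)
    then show "q \<notin> interior U"
      using d(1) cell_subset_closure by blast
  qed
  have "q \<in> contour \<eta> \<longleftrightarrow> q \<in> closure U \<and> q \<notin> interior U"
    by (simp add: contour_def U_def frontier_def cell_def)
  with * ** show ?thesis by blast
qed

section \<open>Jordan curves have no branch points\<close>

text \<open>A Jordan curve is a circle, so it becomes an open interval when a point is removed. The second
  property says that the removed point can only be approached through the ends of this
  interval.\<close>

lemma Jordan_curve_minus_point:
  assumes "Jordan_curve C" "p \<in> C"
  obtains g h where "homeomorphism {0<..<1::real} (C - {p}) g h"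
    "\<And>s t. 0 < s \<Longrightarrow> t < 1 \<Longrightarrow> p \<notin> closure (g ` {s..t})"
proof -
  obtain g0 where g0: "simple_path g0" "pathfinish g0 = pathstart g0" "path_image g0 = C"
    using assms(1) by (auto simp: Jordan_curve_def)
  obtain \<tau> where \<tau>: "\<tau> \<in> {0..1}" "g0 \<tau> = p"
    using assms(2) g0(3) by (auto simp: path_image_def)
  define g where "g = shiftpath \<tau> g0"
  have g: "simple_path g" "path_image g = C"
    using g0 \<tau> by (simp_all add: g_def simple_path_shiftpath path_image_shiftpath)
  have ends: "g 0 = p" "g 1 = p"
    using \<tau> g0 pathstart_shiftpath[of \<tau> g0] pathfinish_shiftpath[of \<tau> g0]
    by (auto simp: g_def pathstart_def pathfinish_def shiftpath_def)
  have cont: "continuous_on {0..1} g"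
    using g(1) by (simp add: simple_path_def path_def)
  have inj: "x = y \<or> x = 0 \<and> y = 1 \<or> x = 1 \<and> y = 0"
    if "x \<in> {0..1}" "y \<in> {0..1}" "g x = g y" for x y
    using g(1) that by (auto simp: simple_path_def loop_free_def)
  have np: "g x \<noteq> p" if "0 < x" "x < 1" for x
    using inj[of x 0] that ends by auto
  have im: "g ` {0<..<1} = C - {p}"
  proof
    show "g ` {0<..<1} \<subseteq> C - {p}"
      using np g(2) unfolding path_image_def by fastforce
    show "C - {p} \<subseteq> g ` {0<..<1}"
    proof
      fix y assume y: "y \<in> C - {p}"
      then obtain x where x: "x \<in> {0..1}" "y = g x"
        using g(2) by (auto simp: path_image_def)
      moreover have "x \<noteq> 0" "x \<noteq> 1" using x y ends by auto
      ultimately show "y \<in> g ` {0<..<1}" by auto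
    qed
  qed
  have "\<exists>h. homeomorphism {0<..<1} (C - {p}) g h"
  proof (rule homeomorphism_injective_closed_map)
    show "continuous_on {0<..<1} g"
      by (rule continuous_on_subset[OF cont]) auto
    show "g ` {0<..<1} = C - {p}" by (rule im)
    show "inj_on g {0<..<1}"
    proof (rule inj_onI)
      fix x y :: real assume "x \<in> {0<..<1}" "y \<in> {0<..<1}" "g x = g y"
      then show "x = y" using inj[of x y] by auto
    qed
    \<comment> \<open>Adding both ends to a relatively closed set makes it compact, and changes its image by
      \<open>p\<close> at most.\<close>
    fix F assume "closedin (top_of_set {0<..<1::real}) F"
    then obtain K where K: "closed K" "F = {0<..<1} \<inter> K"
      by (auto simp: closedin_closed)
    let ?L = "(K \<inter> {0..1}) \<union> {0, 1}"
    have "compact ?L"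
      using K(1) by (simp add: closed_Int_compact)
    then have "compact (g ` ?L)"
      by (intro compact_continuous_image continuous_on_subset[OF cont, of ?L]) auto
    moreover have "g ` F = (C - {p}) \<inter> g ` ?L"
    proof
      show "g ` F \<subseteq> (C - {p}) \<inter> g ` ?L"
        using im K(2) by auto
      show "(C - {p}) \<inter> g ` ?L \<subseteq> g ` F"
      proof
        fix y assume y: "y \<in> (C - {p}) \<inter> g ` ?L"
        then obtain x where x: "x \<in> ?L" "y = g x" by blast
        then have "x \<noteq> 0" "x \<noteq> 1" using y ends by auto
        with x K(2) have "x \<in> F" by auto
        with x show "y \<in> g ` F" by blast
      qed
    qed
    ultimately show "closedin (top_of_set (C - {p})) (g ` F)"
      by (metis closedin_closed_Int compact_imp_closed)
  qed blast
  moreover have "p \<notin> closure (g ` {s..t})" if "0 < s" "t < 1" for s t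
  proof -
    have "compact (g ` {s..t})"
      using that by (intro compact_continuous_image continuous_on_subset[OF cont, of "{s..t}"]) auto
    then have "closure (g ` {s..t}) = g ` {s..t}"
      by (simp add: compact_imp_closed)
    moreover have "g x \<noteq> p" if "x \<in> {s..t}" for x using that np \<open>0 < s\<close> \<open>t < 1\<close> by simp
    ultimately show ?thesis by (metis imageE)
  qed
  ultimately show ?thesis using that by blast
qed

text \<open>Seen in the open interval, each arm is a subinterval that reaches one of the two ends. Of three
  arms two reach the same end, and then they overlap.\<close>

lemma Jordan_curve_no_triod:
  assumes C: "Jordan_curve C" and p: "p \<in> C"
    and arms: "\<And>i. i < (3::nat) \<Longrightarrow> connected (A i) \<and> A i \<subseteq> C - {p} \<and> p \<in> closure (A i)"
    and disj: "\<And>i j. i < 3 \<Longrightarrow> j < 3 \<Longrightarrow> i \<noteq> j \<Longrightarrow> A i \<inter> A j = {}"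
  shows False
proof -
  obtain g h where hom: "homeomorphism {0<..<1::real} (C - {p}) g h"
    and far: "\<And>s t. 0 < s \<Longrightarrow> t < 1 \<Longrightarrow> p \<notin> closure (g ` {s..t})"
    using Jordan_curve_minus_point[OF C p] by blast
  define J where "J i = h ` A i" for i
  have sub: "J i \<subseteq> {0<..<1}" if "i < 3" for i
  proof -
    have "J i \<subseteq> h ` (C - {p})" unfolding J_def using arms[OF that] by blast
    then show ?thesis using hom by (simp add: homeomorphism_def)
  qed
  have gJ: "g ` J i = A i" if "i < 3" for i
  proof -
    have "g (h y) = y" if "y \<in> A i" for y
      using arms[OF \<open>i < 3\<close>] hom that unfolding homeomorphism_def by blast
    then show ?thesis by (simp add: J_def image_image)
  qed
  have between: "x \<in> J i" if "i < 3" "u \<in> J i" "v \<in> J i" "u \<le> x" "x \<le> v" for i u v x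
  proof -
    have "continuous_on (A i) h"
      using arms[OF that(1)] hom by (meson continuous_on_subset homeomorphism_def)
    then have "connected (J i)"
      unfolding J_def using arms[OF that(1)] connected_continuous_image by blast
    then show ?thesis
      using that(2-5) by (meson connectedD_interval)
  qed
  have disjJ: "J i \<inter> J j = {}" if "i < 3" "j < 3" "i \<noteq> j" for i j
    using disj[OF that] gJ[OF that(1)] gJ[OF that(2)] by blast
  define L R where "L i \<longleftrightarrow> (\<forall>s>0. \<exists>x\<in>J i. x < s)" and "R i \<longleftrightarrow> (\<forall>t<1. \<exists>x\<in>J i. x > t)" for i
  \<comment> \<open>Staying away from both ends, an arm would lie in a compact subarc missing \<open>p\<close>.\<close>
  have acc: "L i \<or> R i" if i: "i < 3" for i
  proof (rule ccontr)
    assume "\<not> ?thesis"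
    then obtain s t where st: "0 < s" "t < 1" "\<And>x. x \<in> J i \<Longrightarrow> s \<le> x \<and> x \<le> t"
      unfolding L_def R_def by (meson linorder_not_less)
    then have "A i \<subseteq> g ` {s..t}" using gJ[OF i] by fastforce
    then have "p \<in> closure (g ` {s..t})"
      using arms[OF i] closure_mono by blast
    with far[OF st(1,2)] show False by blast
  qed
  have ne: "J i \<noteq> {}" if "i < 3" for i
    using arms[OF that] by (auto simp: J_def)
  have left: False
    if ij: "i < 3" "j < 3" "i \<noteq> j" and i: "L i" and j: "L j" for i j
  proof -
    obtain u v where uv: "u \<in> J i" "v \<in> J j" using ne ij by blast
    then have pos: "0 < u" "0 < v" using sub ij by fastforce+
    obtain u' where "u' \<in> J i" "u' < v" using i pos unfolding L_def by blast
    moreover obtain v' where "v' \<in> J j" "v' < u" using j pos unfolding L_def by blast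
    ultimately have "min u v \<in> J i \<inter> J j"
      using uv between[OF ij(1), of u' u "min u v"] between[OF ij(2), of v' v "min u v"]
      by (auto simp: min_def split: if_splits)
    with disjJ[OF ij] show False by blast
  qed
  have right: False
    if ij: "i < 3" "j < 3" "i \<noteq> j" and i: "R i" and j: "R j" for i j
  proof -
    obtain u v where uv: "u \<in> J i" "v \<in> J j" using ne ij by blast
    then have less: "u < 1" "v < 1" using sub ij by fastforce+
    obtain u' where "u' \<in> J i" "v < u'" using i less unfolding R_def by blast
    moreover obtain v' where "v' \<in> J j" "u < v'" using j less unfolding R_def by blast
    ultimately have "max u v \<in> J i \<inter> J j"
      using uv between[OF ij(1), of u u' "max u v"] between[OF ij(2), of v v' "max u v"]
      by (auto simp: max_def split: if_splits)
    with disjJ[OF ij] show False by blast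
  qed
  show False
    using acc[of 0] acc[of 1] acc[of 2] left[of 0 1] left[of 0 2] left[of 1 2]
      right[of 0 1] right[of 0 2] right[of 1 2]
    by auto
qed

text \<open>Otherwise the types would alternate around the centre of the block, where four edges of the
  contour would then meet. Three of them form a triod.\<close>

lemma Jordan_contour_no_checkerboard:
  assumes J: "Jordan_curve (contour \<eta>)"
    and diag: "\<eta> (a, b) = 1 \<longleftrightarrow> \<eta> (a + 1, b + 1) = 1"
  shows "(\<eta> (a + 1, b) = 1 \<longleftrightarrow> \<eta> (a, b) = 1) \<or> (\<eta> (a, b + 1) = 1 \<longleftrightarrow> \<eta> (a, b) = 1)"
proof (rule ccontr)
  assume "\<not> ?thesis"
  then have sides: "\<eta> (a + 1, b) = 1 \<longleftrightarrow> \<eta> (a, b) \<noteq> 1" "\<eta> (a, b + 1) = 1 \<longleftrightarrow> \<eta> (a, b) \<noteq> 1"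
    by blast+
  define p1 p2 where "p1 = real_of_int a + 1/2" and "p2 = real_of_int b + 1/2"
  define A :: "nat \<Rightarrow> (real \<times> real) set" where
    "A i = (if i = 0 then {p1<..p1 + 1/2} \<times> {p2}
            else if i = 1 then {p1 - 1/2..<p1} \<times> {p2}
            else {p1} \<times> {p2<..p2 + 1/2})" for i
  have on: "q \<in> contour \<eta>"
    if "q \<in> cell c" "q \<in> cell d"
      "(\<eta> c = 1) \<noteq> (\<eta> d = 1)" for q c d
    using that unfolding contour_iff by blast
  have p: "(p1, p2) \<in> contour \<eta>"
    by (rule on[of _ "(a, b)" "(a + 1, b)"]) (use sides in \<open>auto simp: mem_cell_iff p1_def p2_def\<close>)
  have "A 0 \<subseteq> contour \<eta>"
    by (intro subsetI on[of _ "(a + 1, b)" "(a + 1, b + 1)"])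
      (use diag sides in \<open>auto simp: A_def mem_cell_iff p1_def p2_def abs_le_iff\<close>)
  moreover have "A 1 \<subseteq> contour \<eta>"
    by (intro subsetI on[of _ "(a, b)" "(a, b + 1)"])
      (use diag sides in \<open>auto simp: A_def mem_cell_iff p1_def p2_def abs_le_iff\<close>)
  moreover have "A 2 \<subseteq> contour \<eta>"
    by (intro subsetI on[of _ "(a, b + 1)" "(a + 1, b + 1)"])
      (use diag sides in \<open>auto simp: A_def mem_cell_iff p1_def p2_def abs_le_iff\<close>)
  ultimately have sub: "A i \<subseteq> contour \<eta>" if "i < 3" for i
    using that by (auto simp: less_Suc_eq numeral_3_eq_3 numeral_2_eq_2)
  show False
  proof (rule Jordan_curve_no_triod[OF J p, of A])
    fix i :: nat assume "i < 3"
    have "connected (A i)"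
      by (auto simp: A_def intro!: connected_Times)
    moreover have "(p1, p2) \<notin> A i" by (auto simp: A_def)
    moreover have "(p1, p2) \<in> closure (A i)"
      by (auto simp: A_def closure_Times)
    ultimately show "connected (A i) \<and> A i \<subseteq> contour \<eta> - {(p1, p2)} \<and> (p1, p2) \<in> closure (A i)"
      using sub[OF \<open>i < 3\<close>] by auto
  next
    fix i j :: nat assume "i < 3" "j < 3" "i \<noteq> j"
    then show "A i \<inter> A j = {}" by (auto simp: A_def)
  qed
qed

section \<open>Turning points of the contour\<close>

text \<open>One coordinate of the argument for the isolated point in the lemma after this one: close to
  \<open>p\<close>, the block only meets squares in the column of \<open>x\<close>, unless the point has the coordinate of
  \<open>p\<close> itself.\<close>

lemma near_dual_coordinate:
  fixes q :: real and x c s :: int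
  assumes "s \<in> {1, -1}" "\<bar>q - (x + s / 2)\<bar> \<le> 1" "\<bar>q - (x - s / 2)\<bar> < 1" "\<bar>q - c\<bar> \<le> 1/2"
  shows "c = x \<or> c = x - s \<and> q = x - s / 2"
proof -
  consider "s = 1" | "s = -1" using assms(1) by blast
  then show ?thesis
  proof cases
    case 1
    with assms have "c \<in> {x - 1, x}"
      by (auto simp: abs_if split: if_splits)
    with 1 assms show ?thesis by (auto simp: abs_if split: if_splits)
  next
    case 2
    with assms have "c \<in> {x, x + 1}"
      by (auto simp: abs_if split: if_splits)
    with 2 assms show ?thesis by (auto simp: abs_if split: if_splits)
  qed
qed

text \<open>Here \<open>v = (x1 - s, x2 - t)\<close> is the odd vertex of the block, \<open>p\<close> is the turning point of the
  contour, and \<open>B\<close> is the union of the four squares of the opposite block \<open>{x1, x1 + s} \<times>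
  {x2, x2 + t}\<close>, with \<open>p\<close> as a corner. Near \<open>p\<close>, the points of \<open>B\<close> other than \<open>p\<close> lie only in
  squares of the three vertices of one type around \<open>p\<close>, so \<open>p\<close> is isolated in the connected set \<open>B \<inter> contour \<eta>\<close>, which therefore is \<open>{p}\<close>. So
  the other three dual points next to \<open>(x1, x2)\<close>, which belong to \<open>B\<close>, are not on the contour:
  each is shared by the squares of four vertices of one type, among them \<open>(x1, x2)\<close>.\<close>

lemma turn_fills_square:
  fixes x1 x2 s t i j :: int
  assumes conn: "\<forall>z\<in>dual_lattice. connected ((+) z ` D2 \<inter> contour \<eta>)"
    and s: "s \<in> {1, -1}" and t: "t \<in> {1, -1}"
    and odd: "(\<eta> (x1 - s, x2 - t) = 1) \<noteq> (\<eta> (x1, x2) = 1)"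
    and sides: "(\<eta> (x1 - s, x2) = 1) = (\<eta> (x1, x2) = 1)" "(\<eta> (x1, x2 - t) = 1) = (\<eta> (x1, x2) = 1)"
    and ij: "i \<in> {-1, 0, 1}" "j \<in> {-1, 0, 1}" "(i, j) \<noteq> (- s, - t)"
  shows "(\<eta> (x1 + i, x2 + j) = 1) = (\<eta> (x1, x2) = 1)"
proof -
  define z p :: "real \<times> real" where "z = (x1 + s / 2, x2 + t / 2)" and "p = (x1 - s / 2, x2 - t / 2)"
  define B where "B = (+) z ` D2"
  have mem_B: "q \<in> B \<longleftrightarrow> \<bar>fst q - (x1 + s / 2)\<bar> \<le> 1 \<and> \<bar>snd q - (x2 + t / 2)\<bar> \<le> 1" for q
  proof -
    have "q \<in> B \<longleftrightarrow> q - z \<in> D2"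
      unfolding B_def by (metis (no_types, lifting) add_diff_cancel_left' diff_add_cancel add.commute imageE imageI)
    also have "\<dots> \<longleftrightarrow> \<bar>fst q - (x1 + s / 2)\<bar> \<le> 1 \<and> \<bar>snd q - (x2 + t / 2)\<bar> \<le> 1"
      unfolding D2_def z_def mem_Times_iff by (auto simp: abs_le_iff)
    finally show ?thesis .
  qed
  have "z = point (if s = 1 then x1 else x1 - 1, if t = 1 then x2 else x2 - 1) + (1/2, 1/2)"
    using s t by (auto simp: z_def point_def)
  then have "z \<in> dual_lattice" by (auto simp: dual_lattice_def)
  then have connB: "connected (B \<inter> contour \<eta>)" using conn by (simp add: B_def)
  have "p \<in> cell (x1, x2)" "p \<in> cell (x1 - s, x2 - t)" "p \<in> B"
    using s t by (auto simp: mem_cell_iff mem_B p_def)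
  with odd have p: "p \<in> B \<inter> contour \<eta>" by (auto simp: contour_iff)
  let ?N = "{fst p - 1<..<fst p + 1} \<times> {snd p - 1<..<snd p + 1}"
  have isolated: "q = p" if q: "q \<in> B \<inter> contour \<eta>" "q \<in> ?N" for q
  proof (rule ccontr)
    assume "q \<noteq> p"
    have "(\<eta> c = 1) = (\<eta> (x1, x2) = 1)" if "q \<in> cell c" for c
    proof -
      have "\<bar>fst q - (x1 - s / 2)\<bar> < 1" "\<bar>snd q - (x2 - t / 2)\<bar> < 1"
        using q(2) by (cases q; force simp: p_def)+
      then have "fst c = x1 \<or> fst c = x1 - s \<and> fst q = x1 - s / 2"
        "snd c = x2 \<or> snd c = x2 - t \<and> snd q = x2 - t / 2"
        using near_dual_coordinate[OF s, of "fst q" x1 "fst c"]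
          near_dual_coordinate[OF t, of "snd q" x2 "snd c"] q(1) that
        by (auto simp: mem_B mem_cell_iff)
      with \<open>q \<noteq> p\<close> sides show ?thesis by (cases c; cases q) (auto simp: p_def)
    qed
    with q(1) show False by (auto simp: contour_iff)
  qed
  have "B \<inter> contour \<eta> = {p}"
  proof -
    have "openin (top_of_set (B \<inter> contour \<eta>)) {p}"
    proof -
      have "{p} = (B \<inter> contour \<eta>) \<inter> ?N"
      proof
        have "p \<in> ?N" by (auto simp: mem_Times_iff)
        with p show "{p} \<subseteq> (B \<inter> contour \<eta>) \<inter> ?N" by blast
        show "(B \<inter> contour \<eta>) \<inter> ?N \<subseteq> {p}" using isolated by blast
      qed
      moreover have "open ?N" by (intro open_Times) auto
      ultimately show ?thesis by (metis openin_open_Int)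
    qed
    moreover have "closedin (top_of_set (B \<inter> contour \<eta>)) {p}"
      using p by simp
    ultimately show ?thesis
      using connB unfolding connected_clopen by blast
  qed
  moreover
  \<comment> \<open>A dual point next to \<open>(x1, x2)\<close>, other than \<open>p\<close>, that the square of \<open>(x1 + i, x2 + j)\<close>
    contains too; if \<open>i = 0\<close> or \<open>j = 0\<close>, going towards the centre of \<open>B\<close> avoids \<open>p\<close>.\<close>
  define \<sigma> \<tau> where "\<sigma> = (if i = 0 then s else i)" and "\<tau> = (if j = 0 then t else j)"
  have \<sigma>: "\<bar>\<sigma>\<bar> = 1" "i = 0 \<or> i = \<sigma>" and \<tau>: "\<bar>\<tau>\<bar> = 1" "j = 0 \<or> j = \<tau>"
    unfolding \<sigma>_def \<tau>_def using s t ij(1,2) by fastforce+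
  have ne: "\<not> (\<sigma> = - s \<and> \<tau> = - t)"
    unfolding \<sigma>_def \<tau>_def using s t ij(3) by (cases "i = 0"; cases "j = 0") auto
  define q :: "real \<times> real" where "q = (x1 + \<sigma> / 2, x2 + \<tau> / 2)"
  have unit: "\<bar>real_of_int \<sigma>\<bar> = 1" "\<bar>real_of_int \<tau>\<bar> = 1"
    "\<bar>real_of_int s\<bar> = 1" "\<bar>real_of_int t\<bar> = 1"
    using \<sigma>(1) \<tau>(1) s t by auto
  have "q \<in> B"
    unfolding mem_B q_def fst_conv snd_conv using unit by (intro conjI) linarith+
  moreover have "q \<noteq> p"
  proof
    assume "q = p"
    then have "real_of_int \<sigma> = - s" "real_of_int \<tau> = - t" by (simp_all add: q_def p_def)
    then have "\<sigma> = - s" "\<tau> = - t" by linarith+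
    with ne show False by simp
  qed
  ultimately have "q \<notin> contour \<eta>" by blast
  moreover have "q \<in> cell (x1, x2)" "q \<in> cell (x1 + i, x2 + j)"
    using unit(1,2) \<sigma>(2) \<tau>(2) by (auto simp: mem_cell_iff q_def)
  ultimately show ?thesis unfolding contour_iff by blast
qed

section \<open>The majority in the square around a vertex\<close>

text \<open>Read \<open>b i j\<close> as: the vertex at offset \<open>(i, j)\<close> has the type of the centre.
  The hypotheses \<open>opposite\<close>, \<open>turn_h\<close> and \<open>turn_v\<close> come from turns of the contour, \<open>checker\<close> from the
  absence of checkerboards.

  Suppose that the offsets \<open>(s, t)\<close> and \<open>(-s, -t)\<close> both differ from the centre. By \<open>opposite\<close>, at
  least one of \<open>(s, 0)\<close> and \<open>(0, t)\<close> differs, and so does one of \<open>(-s, 0)\<close> and \<open>(0, -t)\<close>. So five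
  agreeing vertices would have to include \<open>(s, -t)\<close>, \<open>(-s, t)\<close> and exactly one of each pair. If
  these two are next to the same one of \<open>(s, -t)\<close> and \<open>(-s, t)\<close>, then \<open>checker\<close> fails at the other
  one; if they are opposite to each other, then \<open>turn_h\<close> or \<open>turn_v\<close> makes \<open>(s, t)\<close> or \<open>(-s, -t)\<close>
  agree.

  Otherwise both ends of some side of the square agree with the centre. If the vertex between
  them differs, then \<open>checker\<close> applied to both ends provides two more agreeing vertices; if it
  agrees, then one of the two vertices beside the centre, parallel to this side, agrees by
  \<open>turn_h\<close> or \<open>turn_v\<close>.\<close>

lemma majority_of_nine:
  fixes b :: "int \<Rightarrow> int \<Rightarrow> bool"
  assumes centre: "b 0 0"
    and opposite: "\<And>s t. s \<in> {1, -1} \<Longrightarrow> t \<in> {1, -1} \<Longrightarrow>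
      \<not> b s t \<Longrightarrow> b s 0 \<Longrightarrow> b 0 t \<Longrightarrow> b (- s) (- t)"
    and checker: "\<And>s t. s \<in> {1, -1} \<Longrightarrow> t \<in> {1, -1} \<Longrightarrow> b s t \<Longrightarrow> b s 0 \<or> b 0 t"
    and turn_h: "\<And>s t. s \<in> {1, -1} \<Longrightarrow> t \<in> {1, -1} \<Longrightarrow>
      b s t \<Longrightarrow> b s 0 \<Longrightarrow> \<not> b 0 t \<Longrightarrow> b 0 (- t) \<and> b s (- t)"
    and turn_v: "\<And>s t. s \<in> {1, -1} \<Longrightarrow> t \<in> {1, -1} \<Longrightarrow>
      b s t \<Longrightarrow> b 0 t \<Longrightarrow> \<not> b s 0 \<Longrightarrow> b (- s) 0 \<and> b (- s) t"
  shows "(\<Sum>i\<in>{-1, 0, 1}. \<Sum>j\<in>{-1, 0, 1}. of_bool (b i j)) \<ge> (5::nat) \<longleftrightarrow>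
    \<not> (\<not> b (-1) (-1) \<and> \<not> b 1 1 \<or> \<not> b (-1) 1 \<and> \<not> b 1 (-1))"
proof -
  define N :: nat where "N = (\<Sum>i\<in>{-1, 0, 1}. \<Sum>j\<in>{-1, 0, 1}. of_bool (b i j))"
  have expand: "(\<Sum>i\<in>{-1, 0, 1}. \<Sum>j\<in>{-1, 0, 1}. f i j) =
      f 0 0 + f s t + f s 0 + f s (- t) + f 0 t + f 0 (- t) + f (- s) t + f (- s) 0 + f (- s) (- t)"
    if "s \<in> {1, -1}" "t \<in> {1, -1}" for s t and f :: "int \<Rightarrow> int \<Rightarrow> nat"
    using that by (elim insertE emptyE) simp_all
  have N: "N = 1 + of_bool (b s t) + of_bool (b s 0) + of_bool (b s (- t)) + of_bool (b 0 t)
      + of_bool (b 0 (- t)) + of_bool (b (- s) t) + of_bool (b (- s) 0) + of_bool (b (- s) (- t))"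
    if "s \<in> {1, -1}" "t \<in> {1, -1}" for s t
    unfolding N_def expand[OF that] by (simp only: centre of_bool_eq)
  have neg: "- s \<in> {1, -1}" if "s \<in> {1, -1}" for s :: int
    using that by auto
  have corner: "N < 5" if st: "s \<in> {1, -1}" "t \<in> {1, -1}" and "\<not> b s t" "\<not> b (- s) (- t)" for s t
    unfolding N[OF st]
    using that(3,4) opposite[OF st] opposite[OF neg[OF st(1)] neg[OF st(2)]]
      checker[OF st(1) neg[OF st(2)]] checker[OF neg[OF st(1)] st(2)]
      turn_h[OF st(1) neg[OF st(2)]] turn_v[OF st(1) neg[OF st(2)]]
    by (cases "b s 0"; cases "b 0 t"; cases "b (- s) 0"; cases "b 0 (- t)") auto
  have row: "N \<ge> 5" if st: "s \<in> {1, -1}" "t \<in> {1, -1}" and "b s t" "b s (- t)" for s t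
    unfolding N[OF st]
    using that(3,4) checker[OF st] checker[OF st(1) neg[OF st(2)]] turn_h[OF st]
    by (cases "b s 0"; cases "b 0 t") auto
  have column: "N \<ge> 5" if st: "s \<in> {1, -1}" "t \<in> {1, -1}" and "b s t" "b (- s) t" for s t
    unfolding N[OF st]
    using that(3,4) checker[OF st] checker[OF neg[OF st(1)] st(2)] turn_v[OF st]
    by (cases "b s 0"; cases "b 0 t") auto
  have "N \<ge> 5 \<longleftrightarrow> \<not> (\<not> b (-1) (-1) \<and> \<not> b 1 1 \<or> \<not> b (-1) 1 \<and> \<not> b 1 (-1))"
    using corner[of 1 1] corner[of 1 "-1"] row[of 1 1] row[of "-1" "-1"]
      column[of 1 1] column[of "-1" "-1"]
    by (simp add: not_le[symmetric]) blast
  then show ?thesis by (simp only: N_def)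
qed

lemma card_type1_Q:
  "card (type1 \<eta> \<inter> Q (x1, x2)) =
     (\<Sum>i\<in>{-1, 0, 1}. \<Sum>j\<in>{-1, 0, 1}. of_bool (\<eta> (x1 + i, x2 + j) = 1))"
proof -
  let ?N = "{-1, 0, 1 :: int} \<times> {-1, 0, 1 :: int}"
  have "type1 \<eta> \<inter> Q (x1, x2) = (+) (x1, x2) ` {d \<in> ?N. \<eta> ((x1, x2) + d) = 1}"
    unfolding Q_def type1_def by blast
  then have "card (type1 \<eta> \<inter> Q (x1, x2)) = card {d \<in> ?N. \<eta> ((x1, x2) + d) = 1}"
    by (simp add: card_image)
  also have "\<dots> = (\<Sum>d\<in>?N. of_bool (\<eta> ((x1, x2) + d) = 1))"
    by (simp add: sum_of_bool_eq Int_def)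
  also have "\<dots> = (\<Sum>i\<in>{-1, 0, 1}. \<Sum>j\<in>{-1, 0, 1}. of_bool (\<eta> (x1 + i, x2 + j) = 1))"
    by (subst sum.cartesian_product) (auto intro!: sum.cong)
  finally show ?thesis .
qed

text \<open>In other words, the majority type around \<open>x\<close> is the type of \<open>x\<close> unless \<open>x\<close> is a corner. The
  properties required of the nine vertices come from turns in the blocks around \<open>x\<close>, seen from
  \<open>x\<close> (for \<open>opposite\<close>) or from a neighbour of \<open>x\<close> of the same type (for \<open>turn_h\<close> and
  \<open>turn_v\<close>).\<close>

lemma majority_iff:
  assumes reg: "regular_cluster \<eta>"
  shows "card (type1 \<eta> \<inter> Q x) \<ge> 5 \<longleftrightarrow> (\<eta> x = 1 \<longleftrightarrow> \<not> corner \<eta> x)"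
proof -
  obtain x1 x2 where x: "x = (x1, x2)" by (cases x)
  have conn: "\<forall>z\<in>dual_lattice. connected ((+) z ` D2 \<inter> contour \<eta>)"
    and J: "Jordan_curve (contour \<eta>)" and conf: "configuration \<eta>"
    using reg by (auto simp: regular_cluster_def cluster_def)
  define b where "b i j \<longleftrightarrow> (\<eta> (x1 + i, x2 + j) = 1) = (\<eta> (x1, x2) = 1)" for i j
  have binary: "\<eta> y = 0 \<or> \<eta> y = 1" for y
    using conf by (auto simp: configuration_def)
  have eq_iff: "\<eta> y = \<eta> z \<longleftrightarrow> (\<eta> y = 1) = (\<eta> z = 1)" for y z
    using binary[of y] binary[of z] by auto
  have corner: "corner \<eta> x \<longleftrightarrow> \<not> b (-1) (-1) \<and> \<not> b 1 1 \<or> \<not> b (-1) 1 \<and> \<not> b 1 (-1)"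
    unfolding corner_def eq_iff by (auto simp: x b_def e1_def e2_def)
  have fill: "b (k + i) (l + j)"
    if "s \<in> {1, -1}" "t \<in> {1, -1}" "\<not> b (k - s) (l - t)" "b (k - s) l" "b k (l - t)" "b k l"
      "i \<in> {-1, 0, 1}" "j \<in> {-1, 0, 1}" "(i, j) \<noteq> (- s, - t)" for k l s t i j
  proof -
    have "(\<eta> (x1 + k + i, x2 + l + j) = 1) = (\<eta> (x1 + k, x2 + l) = 1)"
      by (rule turn_fills_square[OF conn that(1,2) _ _ _ that(7,8,9)])
        (use that(3-6) in \<open>simp_all add: b_def add_diff_eq\<close>)
    with \<open>b k l\<close> show ?thesis by (simp add: b_def add.assoc)
  qed
  define N :: nat where "N = (\<Sum>i\<in>{-1, 0, 1}. \<Sum>j\<in>{-1, 0, 1}. of_bool (b i j))"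
  have count: "N \<ge> 5 \<longleftrightarrow> \<not> corner \<eta> x"
    unfolding N_def corner
  proof (rule majority_of_nine)
    show b00: "b 0 0" by (simp add: b_def)
    fix s t :: int assume s: "s \<in> {1, -1}" and t: "t \<in> {1, -1}"
    have neg: "- s \<in> {1, -1}" "- t \<in> {1, -1}" using s t by auto
    have nz: "s \<noteq> - s" "t \<noteq> - t" and digit: "- s \<in> {-1, 0, 1}" "- t \<in> {-1, 0, 1}" "0 \<in> {-1, 0, 1::int}"
      using s t by auto
    show "b (- s) (- t)" if "\<not> b s t" "b s 0" "b 0 t"
      using fill[OF neg, of 0 0 "- s" "- t"] b00 digit nz that by simp
    show "b s 0 \<or> b 0 t" if "b s t"
    proof (rule ccontr)
      assume "\<not> (b s 0 \<or> b 0 t)"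
      then show False
        using Jordan_contour_no_checkerboard[OF J, of "min x1 (x1 + s)" "min x2 (x2 + t)"] s t that
        by (auto simp: b_def min_def)
    qed
    show "b 0 (- t) \<and> b s (- t)" if "b s t" "b s 0" "\<not> b 0 t"
      using fill[OF s neg(2), of s 0 "- s" "- t"] fill[OF s neg(2), of s 0 0 "- t"]
        b00 digit nz that by simp
    show "b (- s) 0 \<and> b (- s) t" if "b s t" "b 0 t" "\<not> b s 0"
      using fill[OF neg(1) t, of 0 t "- s" "- t"] fill[OF neg(1) t, of 0 t "- s" 0]
        b00 digit nz that by simp
  qed
  show ?thesis
  proof (cases "\<eta> x = 1")
    case True
    then have "b i j \<longleftrightarrow> \<eta> (x1 + i, x2 + j) = 1" for i j
      by (simp add: b_def x)
    then have "card (type1 \<eta> \<inter> Q x) = N"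
      unfolding x card_type1_Q N_def by (simp only:)
    with True count show ?thesis by simp
  next
    case False
    then have "of_bool (\<eta> (x1 + i, x2 + j) = 1) + of_bool (b i j) = (1::nat)" for i j
      by (simp add: b_def x)
    then have "card (type1 \<eta> \<inter> Q x) + N = (\<Sum>i\<in>{-1, 0, 1 :: int}. \<Sum>j\<in>{-1, 0, 1 :: int}. 1)"
      unfolding x card_type1_Q N_def sum.distrib[symmetric] by (simp only:)
    then have "card (type1 \<eta> \<inter> Q x) \<ge> 5 \<longleftrightarrow> \<not> N \<ge> 5" by auto
    with False count show ?thesis by simp
  qed
qed

section \<open>Counting\<close>

lemma mem_Q_iff: "y \<in> Q x \<longleftrightarrow> \<bar>fst y - fst x\<bar> \<le> 1 \<and> \<bar>snd y - snd x\<bar> \<le> 1"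
proof -
  have "y \<in> Q x \<longleftrightarrow> y - x \<in> {-1, 0, 1} \<times> {-1, 0, 1}"
    unfolding Q_def by (metis (no_types, lifting) add_diff_cancel_left' diff_add_cancel add.commute imageE imageI)
  moreover have "z \<in> {-1, 0, 1} \<longleftrightarrow> \<bar>z\<bar> \<le> 1" for z :: int
    by auto
  ultimately show ?thesis by (simp only: mem_Times_iff fst_diff snd_diff)
qed

text \<open>Double counting: \<open>y \<in> Q x\<close> is symmetric in \<open>x\<close> and \<open>y\<close>, so a type 1 vertex is counted in nine
  squares.\<close>

lemma
  assumes fin: "finite (type1 \<eta>)"
  shows finite_majority: "finite {x. card (type1 \<eta> \<inter> Q x) \<ge> 5}"
    and has_sum_phi: "(\<phi> \<eta> has_sum
    9 * (int (card {x. card (type1 \<eta> \<inter> Q x) \<ge> 5}) - int (card (type1 \<eta>)))) UNIV"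
proof -
  define S where "S = type1 \<eta>"
  define M where "M = {x. card (S \<inter> Q x) \<ge> 5}"
  define B where "B = (\<Union>y\<in>S. Q y)"
  have Q_sym: "y \<in> Q x \<longleftrightarrow> x \<in> Q y" for x y
    by (auto simp: mem_Q_iff)
  have card_Q: "card (Q x) = 9" for x
    unfolding Q_def by (simp add: card_image card_cartesian_product)
  have finQ: "finite (Q x)" for x by (simp add: Q_def)
  have finB: "finite B" using fin finQ by (simp add: B_def S_def)
  have empty: "S \<inter> Q x = {}" if "x \<notin> B" for x
    using that Q_sym by (auto simp: B_def)
  then have MB: "M \<subseteq> B" by (force simp: M_def)
  have "(\<Sum>x\<in>B. card {y\<in>S. y \<in> Q x}) = 9 * card S"
  proof (rule sum_multicount)
    show "\<forall>y\<in>S. card {x \<in> B. y \<in> Q x} = 9"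
    proof
      fix y assume "y \<in> S"
      then have "{x \<in> B. y \<in> Q x} = Q y" using Q_sym by (auto simp: B_def)
      then show "card {x \<in> B. y \<in> Q x} = 9" by (simp add: card_Q)
    qed
  qed (use fin finB in \<open>simp_all add: S_def\<close>)
  moreover have "\<phi> \<eta> x = 9 * of_bool (x \<in> M) - int (card {y\<in>S. y \<in> Q x})" for x
    by (auto simp: \<phi>_def M_def S_def Int_def)
  moreover have "(\<Sum>x\<in>B. of_bool (x \<in> M)) = int (card M)"
    using MB finB by (simp add: sum_of_bool_eq Int_absorb1)
  ultimately have "sum (\<phi> \<eta>) B = 9 * (int (card M) - int (card S))"
    by (simp add: sum_subtractf flip: sum_distrib_left of_nat_sum)
  moreover have "(\<phi> \<eta> has_sum sum (\<phi> \<eta>) B) UNIV"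
  proof (rule has_sum_cong_neutral[THEN iffD1])
    show "(\<phi> \<eta> has_sum sum (\<phi> \<eta>) B) B" using finB by (rule has_sum_finite)
    show "\<phi> \<eta> x = 0" if "x \<in> UNIV - B" for x
      using that empty by (simp add: \<phi>_def S_def)
  qed auto
  ultimately show "(\<phi> \<eta> has_sum
    9 * (int (card {x. card (type1 \<eta> \<inter> Q x) \<ge> 5}) - int (card (type1 \<eta>)))) UNIV"
    by (simp add: M_def S_def)
  show "finite {x. card (type1 \<eta> \<inter> Q x) \<ge> 5}"
    using MB finB finite_subset by (simp add: M_def S_def)
qed

theorem theorem5:
  fixes \<eta> :: "int \<times> int \<Rightarrow> nat"
  assumes "regular_cluster \<eta>"
    and "card (type1 \<eta>) \<ge> 11"
  shows "(\<phi> \<eta> has_sum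
           9 * (int (card (negative_corners \<eta>)) - int (card (positive_corners \<eta>)))) UNIV"
proof -
  \<comment> \<open>The cardinality of an infinite set is \<open>0\<close>.\<close>
  have fin: "finite (type1 \<eta>)"
    using assms(2) by (metis card.infinite not_numeral_le_zero)
  define M where "M = {x. card (type1 \<eta> \<inter> Q x) \<ge> 5}"
  have M_iff: "x \<in> M \<longleftrightarrow> (\<eta> x = 1 \<longleftrightarrow> \<not> corner \<eta> x)" for x
    using majority_iff[OF assms(1)] by (simp add: M_def)
  have "\<eta> x = 0 \<or> \<eta> x = 1" for x
    using assms(1) by (auto simp: regular_cluster_def cluster_def configuration_def)
  then have split: "M \<union> positive_corners \<eta> = type1 \<eta> \<union> negative_corners \<eta>"
    using M_iff by (auto simp: type1_def positive_corners_def negative_corners_def)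
  have disj: "M \<inter> positive_corners \<eta> = {}" "type1 \<eta> \<inter> negative_corners \<eta> = {}"
    using M_iff by (auto simp: type1_def positive_corners_def negative_corners_def)
  have "finite M" unfolding M_def using fin by (rule finite_majority)
  moreover have "negative_corners \<eta> \<subseteq> M" "positive_corners \<eta> \<subseteq> type1 \<eta>"
    using M_iff by (auto simp: type1_def positive_corners_def negative_corners_def)
  ultimately have "card M + card (positive_corners \<eta>) = card (type1 \<eta>) + card (negative_corners \<eta>)"
    using fin disj split by (metis card_Un_disjoint finite_subset)
  then have "9 * (int (card M) - int (card (type1 \<eta>))) =
      9 * (int (card (negative_corners \<eta>)) - int (card (positive_corners \<eta>)))"
    by (simp add: algebra_simps flip: of_nat_add)
  with has_sum_phi[OF fin] show ?thesis unfolding M_def by (simp only:)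
qed

end
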